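(* Let $X$ and $Y$ be independent nonnegative random variables with distributions $F$ and $G$, where $G$ is not the point mass at $0$, and let $H$ be the distribution of $XY$. Assume $F\in\mathcal S$. Then $H\in\mathcal S$ if and only if either $D[F]=\emptyset$, or $D[F]\neq\emptyset$ and $$\overline G(x/d)-\overline G\big((x+1)/d\big)=o\big(\overline H(x)\big)\quad\text{as }x\to\infty,\ \text{for every } d\in D[F].$$
   Context: For a distribution $V$, $\overline V=1-V$ denotes its tail. All limits are as $x\to\infty$. For positive functions $f,g$: $f(x)\sim g(x)$ means $f(x)/g(x)\to1$, and $f(x)=o(g(x))$ means $f(x)/g(x)\to0$. $D[V]$ denotes the set of all positive points of discontinuity of the distribution $V$. A distribution $V$ on $[0,\infty)$ is subexponential, written $V\in\mathcal S$, if $\overline V(x)>0$ for all $x$ and $\overline{V*V}(x)\sim 2\overline V(x)$, where $V*V$ is the distribution of the sum of two independent copies of a random variable with distribution $V$. *)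

theory Defs
  imports "HOL-Probability.Probability" "HOL-Library.Landau_Symbols"
begin

definition tail :: "real measure \<Rightarrow> real \<Rightarrow> real" where
  "tail V x = 1 - measure V {..x}"

definition conv_distr :: "real measure \<Rightarrow> real measure \<Rightarrow> real measure" where
  "conv_distr V W = distr (V \<Otimes>\<^sub>M W) borel (\<lambda>(a, b). a + b)"

definition subexponential :: "real measure \<Rightarrow> bool" where
  "subexponential V \<longleftrightarrow>
     prob_space V \<and> sets V = sets borel \<and> measure V {..<0} = 0 \<and>
     (\<forall>x. tail V x > 0) \<and>
     (tail (conv_distr V V) \<sim>[at_top] (\<lambda>x. 2 * tail V x))"

definition discont_points :: "real measure \<Rightarrow> real set" where
  "discont_points V = {d. d > 0 \<and> measure V {d} > 0}"

end

theory Submission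
  imports Defs "HOL-Real_Asymp.Real_Asymp"
begin

text \<open>
  Write \<open>f, g, h\<close> for the tails of \<open>F, G, H\<close>. Subexponentiality of \<open>H\<close> amounts to long-tailedness,
  \<open>h (x - 1) \<sim> h x\<close>, together with negligibility of the event that both of two independent copies
  \<open>X\<^sub>1 Y\<^sub>1\<close>, \<open>X\<^sub>2 Y\<^sub>2\<close> exceed a large constant while their sum exceeds \<open>x\<close>.

  Long-tailedness is the only place where the atoms matter. An atom \<open>d\<close> of \<open>F\<close> contributes
  \<open>F {d} (g (x / d) - g ((x + 1) / d))\<close> to \<open>h x - h (x + 1)\<close>, which makes the condition necessary.
  Conversely, for \<open>Y \<le> x / K\<close> the increment of \<open>f\<close> at \<open>x / Y\<close> is small because \<open>F\<close> is
  long-tailed, and for \<open>Y > x / K\<close> it is an increment of \<open>F\<close> over a short interval in \<open>[0, 2 K]\<close>,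
  which is small after removal of the finitely many large atoms.

  Joint exceedance is negligible as soon as \<open>H\<close> is long-tailed: condition on \<open>Y\<^sub>1 = y \<ge> z = Y\<^sub>2\<close> and
  divide by the larger weight. If \<open>X\<^sub>1 > B\<close> and \<open>z X\<^sub>2 > B y\<close>, then \<open>X\<^sub>1, X\<^sub>2 > B\<close> and
  \<open>X\<^sub>1 + X\<^sub>2 > x / y\<close>, which is negligible against \<open>f (x / y)\<close> since \<open>F\<close> is subexponential. In all
  other cases the conditional probability is bounded by products of a function of \<open>y\<close> and a
  function of \<open>z\<close>, and independence of \<open>Y\<^sub>1\<close> and \<open>Y\<^sub>2\<close> gives a small factor times \<open>h x\<close>.
\<close>

section \<open>Long-tailed and subexponential distributions\<close>

locale nonneg_distribution = prob_space V for V :: "real measure" +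
  assumes sets_eq_borel [measurable_cong]: "sets V = sets borel"
    and measure_neg: "measure V {..<0} = 0"
begin

lemma space_eq_UNIV [simp]: "space V = UNIV"
  using sets_eq_imp_space_eq[OF sets_eq_borel] by simp

lemma AE_nonneg: "AE a in V. 0 \<le> a"
proof -
  have "emeasure V {..<0} = 0"
    by (simp add: emeasure_eq_measure measure_neg)
  then show ?thesis
    by (intro AE_I[of _ _ "{..<0}"]) (auto simp: sets_eq_borel)
qed

lemma tail_eq: "tail V x = measure V {x<..}"
proof -
  have "{x<..} = space V - {..x}" by auto
  then show ?thesis
    using prob_compl[of "{..x}"] by (simp add: tail_def sets_eq_borel)
qed

lemma emeasure_greaterThan: "emeasure V {x<..} = ennreal (tail V x)"
  by (simp add: tail_eq emeasure_eq_measure)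

lemma tail_nonneg [simp]: "0 \<le> tail V x"
  by (simp add: tail_eq)

lemma tail_le_1: "tail V x \<le> 1"
  by (simp add: tail_eq)

lemma tail_antimono: "x \<le> y \<Longrightarrow> tail V y \<le> tail V x"
  unfolding tail_eq by (intro finite_measure_mono) (auto simp: sets_eq_borel)

lemma tail_diff:
  assumes "x \<le> y" shows "tail V x - tail V y = measure V {x<..y}"
proof -
  have "{x<..} = {x<..y} \<union> {y<..}" using assms by auto
  then have "measure V {x<..} = measure V {x<..y} + measure V {y<..}"
    by (simp add: finite_measure_Union sets_eq_borel disjoint_iff)
  then show ?thesis by (simp add: tail_eq)
qed

lemma prob_atMost: "measure V {..x} = 1 - tail V x"
  by (simp add: tail_def)

lemma tail_tendsto_0: "(tail V \<longlongrightarrow> 0) at_top"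
proof (rule tendsto_at_topI_sequentially)
  fix X :: "nat \<Rightarrow> real" assume X: "filterlim X at_top sequentially"
  interpret real_distribution V
    by unfold_locales (simp_all add: sets_eq_borel)
  have "(cdf V \<longlongrightarrow> 1) at_top" by (rule cdf_lim_at_top_prob)
  then have "((\<lambda>x. 1 - cdf V x) \<longlongrightarrow> 1 - 1) at_top" by (intro tendsto_intros)
  then show "(\<lambda>n. tail V (X n)) \<longlonglongrightarrow> 0"
    using filterlim_compose[OF _ X] by (simp add: cdf_def tail_def)
qed

lemma ex_tail_less:
  assumes "0 < e" shows "\<exists>c\<ge>b. tail V c < e"
proof -
  have "eventually (\<lambda>x. tail V x < e) at_top"
    using order_tendstoD(2)[OF tail_tendsto_0 assms] .
  with eventually_ge_at_top[of b] have "eventually (\<lambda>x. b \<le> x \<and> tail V x < e) at_top"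
    by eventually_elim auto
  then show ?thesis by (auto simp: eventually_at_top_linorder)
qed

section \<open>Two independent copies: rectangles, convolution tails and joint exceedance\<close>

sublocale VV: pair_prob_space V V ..

lemma VV_rect:
  assumes "A \<in> sets borel" "B \<in> sets borel"
  shows "measure (V \<Otimes>\<^sub>M V) (A \<times> B) = measure V A * measure V B"
  using emeasure_pair_measure_Times[of A V B] assms
  by (simp add: sets_eq_borel VV.emeasure_eq_measure emeasure_eq_measure flip: ennreal_mult)

lemma VV_AE_nonneg: "AE p in V \<Otimes>\<^sub>M V. 0 \<le> fst p \<and> 0 \<le> snd p"
  by (intro VV.AE_pair_measure) (use AE_nonneg in auto)

lemma VV_sets: "sets (V \<Otimes>\<^sub>M V) = sets (borel \<Otimes>\<^sub>M borel)"
  by (intro sets_pair_measure_cong sets_eq_borel)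

lemma VV_pred_sets:
  assumes "Measurable.pred (borel \<Otimes>\<^sub>M borel) P"
  shows "Collect P \<in> sets (V \<Otimes>\<^sub>M V)"
  using assms VV_sets by (simp add: pred_def space_pair_measure)

lemma tail_conv_distr:
  "tail (conv_distr V V) x = measure (V \<Otimes>\<^sub>M V) {p. x < fst p + snd p}"
proof -
  have m: "(\<lambda>(a, b). a + b) \<in> borel_measurable (V \<Otimes>\<^sub>M V)" by measurable
  have "measure (conv_distr V V) {..x} = measure (V \<Otimes>\<^sub>M V) {p. fst p + snd p \<le> x}"
    unfolding conv_distr_def using m
    by (subst measure_distr) (auto simp: space_pair_measure vimage_def case_prod_beta)
  also have "\<dots> = 1 - measure (V \<Otimes>\<^sub>M V) {p. x < fst p + snd p}"
  proof -
    have "{p. fst p + snd p \<le> x} = space (V \<Otimes>\<^sub>M V) - {p. x < fst p + snd p}"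
      by (auto simp: space_pair_measure)
    then show ?thesis by (simp add: VV.prob_compl VV_pred_sets)
  qed
  finally show ?thesis by (simp add: tail_def)
qed

text \<open>Three disjoint rectangles lie, up to a null set, in the event that the sum exceeds
  \<open>x\<close>: first copy above \<open>x\<close>; first at most \<open>y\<close> and second
  above \<open>x\<close>; first in \<open>(y, x]\<close> and second above \<open>x - y\<close>. Only
  the last one brings in a shifted tail.\<close>

lemma tail_conv_distr_ge:
  assumes "y \<le> x"
  shows "tail V x + (1 - tail V y) * tail V x + (tail V y - tail V x) * tail V (x - y)
    \<le> tail (conv_distr V V) x"
proof -
  let ?A = "{x<..} \<times> UNIV" and ?B = "{..y} \<times> {x<..}" and ?C = "{y<..x} \<times> {x - y<..}"
  have "tail V x + (1 - tail V y) * tail V x + (tail V y - tail V x) * tail V (x - y)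
    = measure (V \<Otimes>\<^sub>M V) ?A + measure (V \<Otimes>\<^sub>M V) ?B + measure (V \<Otimes>\<^sub>M V) ?C"
    using assms prob_space
    by (simp add: VV_rect prob_atMost flip: tail_diff tail_eq)
  also have "\<dots> = measure (V \<Otimes>\<^sub>M V) (?A \<union> ?B \<union> ?C)"
    using assms by (subst VV.finite_measure_Union; (subst VV.finite_measure_Union)?)
      (auto simp: sets_eq_borel)
  also have "\<dots> \<le> measure (V \<Otimes>\<^sub>M V) {p. x < fst p + snd p}"
  proof (rule VV.finite_measure_mono_AE)
    show "AE p in V \<Otimes>\<^sub>M V. p \<in> ?A \<union> ?B \<union> ?C \<longrightarrow> p \<in> {p. x < fst p + snd p}"
      using VV_AE_nonneg by eventually_elim auto
  qed (simp add: VV_pred_sets)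
  finally show ?thesis by (simp add: tail_conv_distr)
qed

lemma tail_conv_distr_ge_max:
  "2 * tail V x - (tail V x)\<^sup>2 \<le> tail (conv_distr V V) x"
  using tail_conv_distr_ge[of x x] by (simp add: power2_eq_square algebra_simps)

definition joint_tail :: "real \<Rightarrow> real \<Rightarrow> real" where
  "joint_tail A x = measure (V \<Otimes>\<^sub>M V) {p. A < fst p \<and> A < snd p \<and> x < fst p + snd p}"

lemma joint_tail_antimono:
  assumes "A \<le> A'" "x \<le> x'"
  shows "joint_tail A' x' \<le> joint_tail A x"
  unfolding joint_tail_def
  by (intro VV.finite_measure_mono) (use assms in \<open>auto intro: VV_pred_sets\<close>)

text \<open>The joint event and the two rectangles where one copy is at most \<open>A\<close> and
  the other above \<open>x\<close> are disjoint, and almost surely each forces the sum above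
  \<open>x\<close>. The bounds on \<open>A\<close> give \<open>A \<le> x\<close>, which keeps the
  rectangles apart.\<close>

lemma joint_tail_le:
  assumes "0 \<le> A" "2 * A \<le> x"
  shows "joint_tail A x \<le> tail (conv_distr V V) x - 2 * (1 - tail V A) * tail V x"
proof -
  let ?J = "{p. A < fst p \<and> A < snd p \<and> x < fst p + snd p}"
  let ?B = "{..A} \<times> {x<..}" and ?C = "{x<..} \<times> {..A}"
  have J: "?J \<in> sets (borel \<Otimes>\<^sub>M borel)"
    using VV_pred_sets[of "\<lambda>p. A < fst p \<and> A < snd p \<and> x < fst p + snd p"] by (simp add: VV_sets)
  have "joint_tail A x + 2 * (1 - tail V A) * tail V x
    = measure (V \<Otimes>\<^sub>M V) ?J + measure (V \<Otimes>\<^sub>M V) ?B + measure (V \<Otimes>\<^sub>M V) ?C"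
    by (simp add: VV_rect joint_tail_def prob_atMost algebra_simps flip: tail_eq)
  also have "\<dots> = measure (V \<Otimes>\<^sub>M V) (?J \<union> ?B \<union> ?C)"
    using assms by (subst VV.finite_measure_Union; (subst VV.finite_measure_Union)?)
      (auto simp: VV_sets J)
  also have "\<dots> \<le> measure (V \<Otimes>\<^sub>M V) {p. x < fst p + snd p}"
  proof (rule VV.finite_measure_mono_AE)
    show "AE p in V \<Otimes>\<^sub>M V. p \<in> ?J \<union> ?B \<union> ?C \<longrightarrow> p \<in> {p. x < fst p + snd p}"
      using VV_AE_nonneg by eventually_elim auto
  qed (simp add: VV_pred_sets)
  finally show ?thesis by (simp add: tail_conv_distr)
qed

text \<open>If the sum exceeds \<open>x\<close>, then either both copies exceed \<open>A\<close>, or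
  one is at most \<open>A\<close> and the other exceeds \<open>x - A\<close>.\<close>

lemma tail_conv_distr_le:
  "tail (conv_distr V V) x \<le> 2 * tail V (x - A) + joint_tail A x"
proof -
  let ?J = "{p. A < fst p \<and> A < snd p \<and> x < fst p + snd p}"
  let ?B = "UNIV \<times> {x - A<..}" and ?C = "{x - A<..} \<times> UNIV"
  have J: "?J \<in> sets (borel \<Otimes>\<^sub>M borel)"
    using VV_pred_sets[of "\<lambda>p. A < fst p \<and> A < snd p \<and> x < fst p + snd p"] by (simp add: VV_sets)
  have "tail (conv_distr V V) x \<le> measure (V \<Otimes>\<^sub>M V) (?B \<union> ?C \<union> ?J)"
    unfolding tail_conv_distr
    by (intro VV.finite_measure_mono) (auto simp: VV_sets J)
  also have "\<dots> \<le> measure (V \<Otimes>\<^sub>M V) ?B + measure (V \<Otimes>\<^sub>M V) ?C + measure (V \<Otimes>\<^sub>M V) ?J"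
    by (intro order_trans[OF measure_Un_le] add_right_mono measure_Un_le) (auto simp: VV_sets J)
  also have "\<dots> = 2 * tail V (x - A) + joint_tail A x"
    using prob_space by (simp add: VV_rect joint_tail_def tail_eq)
  finally show ?thesis .
qed


section \<open>Shifts of the argument and long-tailedness\<close>

lemma exists_shift_bound:
  assumes pos: "\<And>x. 0 < tail V x"
    and long: "eventually (\<lambda>x. tail V (x - c) \<le> K * tail V x) at_top"
  shows "\<exists>M>0. \<forall>x. tail V (x - c) \<le> M * tail V x"
proof -
  obtain N where N: "tail V (x - c) \<le> K * tail V x" if "N \<le> x" for x
    using long by (auto simp: eventually_at_top_linorder)
  \<comment> \<open>From \<open>N\<close> on the factor \<open>K\<close> works; below
    \<open>N\<close> the shifted tail is at most 1 while \<open>tail V x\<close> is at least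
    \<open>tail V N\<close>.\<close>
  let ?M = "max K (1 / tail V N)"
  have "tail V (x - c) \<le> ?M * tail V x" for x
  proof (cases "N \<le> x")
    case True
    have "K * tail V x \<le> ?M * tail V x" by (intro mult_right_mono) auto
    with N[OF True] show ?thesis by linarith
  next
    case False
    have "tail V (x - c) \<le> 1" by (rule tail_le_1)
    also have "1 \<le> 1 / tail V N * tail V x"
      using pos[of N] tail_antimono[of x N] False by (simp add: field_simps)
    also have "\<dots> \<le> ?M * tail V x" by (intro mult_right_mono) auto
    finally show ?thesis .
  qed
  moreover have "0 < ?M" using pos[of N] by (simp add: less_max_iff_disj)
  ultimately show ?thesis by blast
qed

text \<open>A division-free form of \<open>tail V (x - c)\<close> being asymptotic to
  \<open>tail V x\<close>; for \<open>c \<ge> 0\<close> the opposite inequality is monotonicity of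
  the tail.\<close>

definition long_tailed :: bool where
  "long_tailed \<longleftrightarrow> (\<forall>c \<epsilon>. 0 < \<epsilon> \<longrightarrow> eventually (\<lambda>x. tail V (x - c) \<le> (1 + \<epsilon>) * tail V x) at_top)"

lemma long_tailedD:
  "long_tailed \<Longrightarrow> 0 < \<epsilon> \<Longrightarrow> eventually (\<lambda>x. tail V (x - c) \<le> (1 + \<epsilon>) * tail V x) at_top"
  by (simp add: long_tailed_def)

lemma long_tailed_diff:
  assumes long_tailed "0 < \<epsilon>"
  shows "eventually (\<lambda>x. tail V x - tail V (x + c) \<le> \<epsilon> * tail V x) at_top"
proof -
  have "eventually (\<lambda>x. tail V (x - c) \<le> (1 + \<epsilon>) * tail V x) at_top"
    using assms by (rule long_tailedD)
  then obtain N where N: "tail V (x - c) \<le> (1 + \<epsilon>) * tail V x" if "N \<le> x" for x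
    by (auto simp: eventually_at_top_linorder)
  have "tail V x - tail V (x + c) \<le> \<epsilon> * tail V x" if "max N (N - c) \<le> x" for x
  proof (cases "0 \<le> c")
    case True
    have "tail V x \<le> (1 + \<epsilon>) * tail V (x + c)" using N[of "x + c"] that by simp
    moreover have "\<epsilon> * tail V (x + c) \<le> \<epsilon> * tail V x"
      using True assms(2) by (intro mult_left_mono tail_antimono) auto
    ultimately show ?thesis by (simp add: algebra_simps)
  next
    case False
    then have "tail V x \<le> tail V (x + c)" by (intro tail_antimono) auto
    moreover have "0 \<le> \<epsilon> * tail V x" using assms(2) by simp
    ultimately show ?thesis by linarith
  qed
  then show ?thesis unfolding eventually_at_top_linorder by blast
qed

text \<open>A small relative increment over unit steps bounds the ratio for a shift by 1; iteration
  gives every integer shift, and monotonicity gives every real one.\<close>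

lemma long_tailedI:
  assumes "\<And>\<epsilon>. 0 < \<epsilon> \<Longrightarrow> eventually (\<lambda>x. tail V x - tail V (x + 1) \<le> \<epsilon> * tail V x) at_top"
  shows long_tailed
proof -
  have step: "eventually (\<lambda>x. tail V (x - 1) \<le> (1 + \<epsilon>) * tail V x) at_top" if "0 < \<epsilon>" for \<epsilon>
  proof -
    \<comment> \<open>Makes \<open>1 - \<delta>\<close> the reciprocal of
      \<open>1 + \<epsilon>\<close>, so that the increment bound at \<open>x - 1\<close> rearranges
      to the ratio bound at \<open>x\<close>.\<close>
    define \<delta> where "\<delta> = \<epsilon> / (1 + \<epsilon>)"
    have \<delta>: "0 < \<delta>" "1 - \<delta> = 1 / (1 + \<epsilon>)" using that by (auto simp: \<delta>_def field_simps)
    obtain N where N: "tail V x - tail V (x + 1) \<le> \<delta> * tail V x" if "N \<le> x" for x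
      using assms[OF \<delta>(1)] by (auto simp: eventually_at_top_linorder)
    have "tail V (x - 1) \<le> (1 + \<epsilon>) * tail V x" if "N + 1 \<le> x" for x
    proof -
      have "(1 - \<delta>) * tail V (x - 1) \<le> tail V x"
        using N[of "x - 1"] that by (simp add: algebra_simps)
      then show ?thesis using \<open>0 < \<epsilon>\<close> unfolding \<delta>(2) by (simp add: field_simps)
    qed
    then show ?thesis by (auto simp: eventually_at_top_linorder)
  qed
  have steps: "\<forall>\<epsilon>>0. eventually (\<lambda>x. tail V (x - real n) \<le> (1 + \<epsilon>) * tail V x) at_top" for n
  proof (induction n)
    case 0
    show ?case by (auto intro!: always_eventually simp: algebra_simps)
  next
    case (Suc n)
    show ?case
    proof (intro allI impI)
      fix \<epsilon> :: real assume "0 < \<epsilon>"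
      \<comment> \<open>Splits \<open>1 + \<epsilon>\<close> into two equal factors, one for the
        extra unit step and one for the induction hypothesis.\<close>
      define \<delta> where "\<delta> = sqrt (1 + \<epsilon>) - 1"
      have \<delta>: "0 < \<delta>" "(1 + \<delta>) * (1 + \<delta>) = 1 + \<epsilon>" using \<open>0 < \<epsilon>\<close> by (auto simp: \<delta>_def)
      have 1: "eventually (\<lambda>x. tail V (x - 1) \<le> (1 + \<delta>) * tail V x) at_top"
        using step[OF \<delta>(1)] .
      have "eventually (\<lambda>x. tail V (x - real n) \<le> (1 + \<delta>) * tail V x) at_top"
        using Suc \<delta>(1) by blast
      then have "eventually (\<lambda>x. tail V (x - 1 - real n) \<le> (1 + \<delta>) * tail V (x - 1)) at_top"
        by (rule eventually_compose_filterlim) real_asymp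
      with 1 show "eventually (\<lambda>x. tail V (x - real (Suc n)) \<le> (1 + \<epsilon>) * tail V x) at_top"
      proof eventually_elim
        case (elim x)
        have "tail V (x - real (Suc n)) = tail V (x - 1 - real n)" by (simp add: algebra_simps)
        also have "\<dots> \<le> (1 + \<delta>) * tail V (x - 1)" by fact
        also have "\<dots> \<le> (1 + \<delta>) * ((1 + \<delta>) * tail V x)"
          using \<delta>(1) elim by (intro mult_left_mono) auto
        finally show ?case by (simp add: \<delta>(2) flip: mult.assoc)
      qed
    qed
  qed
  show ?thesis
    unfolding long_tailed_def
  proof (intro allI impI)
    fix c \<epsilon> :: real assume "0 < \<epsilon>"
    obtain n where n: "c \<le> real n" using real_arch_simple by blast
    have "eventually (\<lambda>x. tail V (x - real n) \<le> (1 + \<epsilon>) * tail V x) at_top"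
      using steps \<open>0 < \<epsilon>\<close> by blast
    then show "eventually (\<lambda>x. tail V (x - c) \<le> (1 + \<epsilon>) * tail V x) at_top"
    proof eventually_elim
      case (elim x)
      have "tail V (x - c) \<le> tail V (x - real n)" using n by (intro tail_antimono) auto
      with elim show ?case by linarith
    qed
  qed
qed

section \<open>Subexponentiality as long-tailedness with negligible joint exceedance\<close>

lemma subexponential_pos: "subexponential V \<Longrightarrow> 0 < tail V x"
  by (simp add: subexponential_def)

lemma subexponential_conv_le:
  assumes "subexponential V" "0 < \<delta>"
  shows "eventually (\<lambda>x. tail (conv_distr V V) x \<le> (2 + \<delta>) * tail V x) at_top"
proof -
  have "((\<lambda>x. tail (conv_distr V V) x / (2 * tail V x)) \<longlongrightarrow> 1) at_top"
    using assms(1) subexponential_pos[OF assms(1)]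
    by (auto simp: subexponential_def intro!: asymp_equivD_strong always_eventually
        simp: less_imp_neq[symmetric])
  moreover have "1 < 1 + \<delta> / 2" using assms(2) by simp
  ultimately have "eventually (\<lambda>x. tail (conv_distr V V) x / (2 * tail V x) < 1 + \<delta> / 2) at_top"
    by (rule order_tendstoD)
  then show ?thesis
  proof eventually_elim
    case (elim x)
    with subexponential_pos[OF assms(1), of x] show ?case by (simp add: field_simps)
  qed
qed

text \<open>The lower bound \<open>tail_conv_distr_ge\<close> at \<open>y = 1\<close> is compared
  with the upper bound \<open>(2 + \<delta>) * tail V x\<close>. The coefficient of
  \<open>tail V (x - 1)\<close> tends to \<open>tail V 1 > 0\<close>, so what remains bounds
  \<open>tail V (x - 1)\<close> by nearly \<open>tail V x\<close>.\<close>

lemma subexponential_imp_long_tailed: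
  assumes "subexponential V"
  shows long_tailed
proof (rule long_tailedI)
  fix \<epsilon> :: real assume "0 < \<epsilon>"
  note pos = subexponential_pos[OF assms]
  \<comment> \<open>With \<open>\<epsilon> * tail V 1 = 2 * \<delta>\<close>, one
    \<open>\<delta>\<close> pays for the convolution error and the other for
    \<open>tail V x\<close>, which is eventually below
    \<open>\<delta> / (1 + \<epsilon>)\<close>.\<close>
  define \<delta> where "\<delta> = \<epsilon> * tail V 1 / 2"
  have "0 < \<delta>" using pos \<open>0 < \<epsilon>\<close> by (simp add: \<delta>_def)
  have "eventually (\<lambda>x. tail V x < \<delta> / (1 + \<epsilon>)) at_top"
    using \<open>0 < \<delta>\<close> \<open>0 < \<epsilon>\<close> by (intro order_tendstoD(2)[OF tail_tendsto_0]) auto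
  moreover have "eventually (\<lambda>x. 1 \<le> x) (at_top :: real filter)"
    by (rule eventually_ge_at_top)
  ultimately have "eventually (\<lambda>x. tail V (x - 1) - tail V x \<le> \<epsilon> * tail V x) at_top"
    using subexponential_conv_le[OF assms \<open>0 < \<delta>\<close>]
  proof eventually_elim
    case (elim x)
    have "tail V x + (1 - tail V 1) * tail V x + (tail V 1 - tail V x) * tail V (x - 1)
        \<le> (2 + \<delta>) * tail V x"
      using tail_conv_distr_ge[of 1 x] elim by linarith
    then have "(tail V 1 - tail V x) * tail V (x - 1) \<le> (tail V 1 + \<delta>) * tail V x"
      by (simp add: algebra_simps)
    also have "\<dots> \<le> (tail V 1 - tail V x) * (1 + \<epsilon>) * tail V x"
      using elim \<open>0 < \<epsilon>\<close> by (intro mult_right_mono) (auto simp: \<delta>_def field_simps)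
    finally have "(tail V 1 - tail V x) * tail V (x - 1)
        \<le> (tail V 1 - tail V x) * ((1 + \<epsilon>) * tail V x)" by (simp add: mult.assoc)
    moreover have "tail V x < tail V 1"
    proof -
      have "\<delta> / (1 + \<epsilon>) < tail V 1"
        using pos[of 1] \<open>0 < \<epsilon>\<close> by (simp add: \<delta>_def field_simps add_pos_pos)
      with elim show ?thesis by linarith
    qed
    ultimately have "tail V (x - 1) \<le> (1 + \<epsilon>) * tail V x"
      by (simp add: mult_le_cancel_left_pos)
    then show ?case by (simp add: algebra_simps)
  qed
  then have "eventually (\<lambda>x. tail V (x + 1 - 1) - tail V (x + 1) \<le> \<epsilon> * tail V (x + 1)) at_top"
    by (rule eventually_compose_filterlim) real_asymp
  then show "eventually (\<lambda>x. tail V x - tail V (x + 1) \<le> \<epsilon> * tail V x) at_top"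
  proof eventually_elim
    case (elim x)
    have "\<epsilon> * tail V (x + 1) \<le> \<epsilon> * tail V x"
      using \<open>0 < \<epsilon>\<close> by (intro mult_left_mono tail_antimono) auto
    with elim show ?case by simp
  qed
qed

text \<open>For large \<open>x\<close> this is \<open>joint_tail_le\<close> combined with the upper
  bound on the convolution tail. The threshold \<open>B\<close> is then raised past the point
  \<open>N\<close> where that begins, which makes the bound uniform in \<open>x\<close>.\<close>

lemma exists_joint_tail_le:
  assumes "subexponential V" "0 < \<epsilon>"
  shows "\<exists>B>0. \<forall>x. joint_tail B x \<le> \<epsilon> * tail V x"
proof -
  obtain A where A: "0 \<le> A" "tail V A < \<epsilon> / 4" using ex_tail_less[of "\<epsilon> / 4" 0] assms(2) by auto
  have "eventually (\<lambda>x. joint_tail A x \<le> \<epsilon> * tail V x) at_top"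
    using subexponential_conv_le[OF assms(1), of "\<epsilon> / 2", OF half_gt_zero[OF assms(2)]]
      eventually_ge_at_top[of "2 * A"]
  proof eventually_elim
    case (elim x)
    have "joint_tail A x \<le> (2 * tail V A + \<epsilon> / 2) * tail V x"
      using joint_tail_le[of A x] A(1) elim by (simp add: algebra_simps)
    also have "\<dots> \<le> \<epsilon> * tail V x" using A(2) by (intro mult_right_mono) auto
    finally show ?case .
  qed
  then obtain N where N: "joint_tail A x \<le> \<epsilon> * tail V x" if "N \<le> x" for x
    by (auto simp: eventually_at_top_linorder)
  define B where "B = max 1 (max A N)"
  have B: "1 \<le> B" "A \<le> B" "N \<le> B" by (auto simp: B_def)
  have large: "joint_tail B x \<le> \<epsilon> * tail V x" if "N \<le> x" for x
    using N[OF that] joint_tail_antimono[OF B(2) order_refl, of x] by linarith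
  have "joint_tail B x \<le> \<epsilon> * tail V x" for x
  proof (cases "2 * B \<le> x")
    case True
    then show ?thesis using B by (intro large) auto
  next
    case False
    \<comment> \<open>Two values above \<open>B\<close> already have a sum above
      \<open>2 * B\<close>, so for \<open>x < 2 * B\<close> nothing is lost by raising
      \<open>x\<close> to \<open>2 * B\<close>.\<close>
    have "joint_tail B x \<le> joint_tail B (2 * B)"
      unfolding joint_tail_def by (intro VV.finite_measure_mono) (auto intro: VV_pred_sets)
    also have "\<dots> \<le> \<epsilon> * tail V (2 * B)" using B by (intro large) auto
    also have "\<dots> \<le> \<epsilon> * tail V x"
      using assms(2) False by (intro mult_left_mono tail_antimono) auto
    finally show ?thesis .
  qed
  with B show ?thesis by (intro exI[of _ B]) auto
qed

text \<open>The lower half of the limit is \<open>tail_conv_distr_ge_max\<close> together with the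
  tail tending to 0. The upper half is \<open>tail_conv_distr_le\<close>: long-tailedness absorbs
  the shift by \<open>A\<close>, and the joint exceedance is small by assumption.\<close>

lemma subexponentialI:
  assumes pos: "\<And>x. 0 < tail V x" and long_tailed
    and joint: "\<And>\<epsilon>. 0 < \<epsilon> \<Longrightarrow> \<exists>A. eventually (\<lambda>x. joint_tail A x \<le> \<epsilon> * tail V x) at_top"
  shows "subexponential V"
proof -
  have "((\<lambda>x. tail (conv_distr V V) x / (2 * tail V x)) \<longlongrightarrow> 1) at_top"
  proof (rule order_tendstoI)
    fix a :: real assume "a < 1"
    then have "eventually (\<lambda>x. tail V x < 2 * (1 - a)) at_top"
      by (intro order_tendstoD(2)[OF tail_tendsto_0]) auto
    then show "eventually (\<lambda>x. a < tail (conv_distr V V) x / (2 * tail V x)) at_top"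
    proof eventually_elim
      case (elim x)
      have "2 * a * tail V x < (2 - tail V x) * tail V x"
        using pos[of x] elim by (intro mult_strict_right_mono) auto
      also have "\<dots> \<le> tail (conv_distr V V) x"
        using tail_conv_distr_ge_max[of x] by (simp add: power2_eq_square algebra_simps)
      finally show ?case using pos[of x] by (simp add: field_simps)
    qed
  next
    fix a :: real assume "1 < a"
    define \<delta> where "\<delta> = (a - 1) / 2"
    have \<delta>: "0 < \<delta>" using \<open>1 < a\<close> by (simp add: \<delta>_def)
    obtain A where A: "eventually (\<lambda>x. joint_tail A x \<le> \<delta> * tail V x) at_top"
      using joint[OF \<delta>] by blast
    show "eventually (\<lambda>x. tail (conv_distr V V) x / (2 * tail V x) < a) at_top"
      using A long_tailedD[OF assms(2) \<delta>, of A]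
    proof eventually_elim
      case (elim x)
      have "tail (conv_distr V V) x \<le> (2 + 3 * \<delta>) * tail V x"
        using tail_conv_distr_le[of x A] elim by (simp add: algebra_simps)
      also have "\<dots> < (2 + 4 * \<delta>) * tail V x"
        using pos[of x] \<delta> by (intro mult_strict_right_mono) auto
      also have "2 + 4 * \<delta> = 2 * a" by (simp add: \<delta>_def field_simps)
      finally show ?case using pos[of x] by (simp add: field_simps)
    qed
  qed
  then have "tail (conv_distr V V) \<sim>[at_top] (\<lambda>x. 2 * tail V x)"
    by (intro asymp_equivI')
  then show ?thesis
    using pos by (simp add: subexponential_def sets_eq_borel measure_neg prob_space_axioms)
qed

section \<open>Atoms and the mass of short intervals\<close>

lemma tail_0_pos:
  assumes "V \<noteq> return borel 0"
  shows "0 < tail V 0"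
proof (rule ccontr)
  assume "\<not> ?thesis"
  then have "measure V {0<..} = 0"
    by (simp add: tail_eq zero_less_measure_iff)
  then have "AE a in V. \<not> 0 < a"
    by (intro AE_I[of _ _ "{0<..}"]) (auto simp: emeasure_eq_measure sets_eq_borel)
  then have "AE a in V. a = 0"
    using AE_nonneg by eventually_elim auto
  have "V = return borel 0"
  proof (rule measure_eqI)
    fix S assume S: "S \<in> sets V"
    have "emeasure V S = emeasure V (if 0 \<in> S then UNIV else {})"
      using \<open>AE a in V. a = 0\<close> S by (intro emeasure_eq_AE) (auto simp: sets_eq_borel)
    then show "emeasure V S = emeasure (return borel 0) S"
      using S emeasure_space_1 by (simp add: sets_eq_borel)
  qed (simp add: sets_eq_borel)
  with assms show False by contradiction
qed

text \<open>Any \<open>n\<close> such atoms together have mass at least \<open>n * \<delta>\<close>,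
  and the total mass is 1.\<close>

lemma finite_large_atoms:
  assumes "0 < \<delta>"
  shows "finite {d. \<delta> \<le> measure V {d}}"
proof (rule ccontr)
  assume inf: "infinite {d. \<delta> \<le> measure V {d}}"
  obtain n where n: "1 < real n * \<delta>" using assms reals_Archimedean3 by blast
  obtain D where D: "D \<subseteq> {d. \<delta> \<le> measure V {d}}" "finite D" "card D = n"
    using infinite_arbitrarily_large[OF inf] by blast
  have "real n * \<delta> = (\<Sum>d\<in>D. \<delta>)" using D by simp
  also have "\<dots> \<le> (\<Sum>d\<in>D. measure V {d})" using D by (intro sum_mono) auto
  also have "\<dots> = measure V D"
    using D by (intro finite_measure_eq_sum_singleton[symmetric]) (auto simp: sets_eq_borel)
  also have "\<dots> \<le> 1" by simp
  finally show False using n by simp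
qed

text \<open>Without the large atoms each single point has mass below \<open>\<delta>\<close>, so by
  continuity from above it has a ball of mass below \<open>\<delta>\<close>. A Lebesgue number of
  this cover of the compact interval is a uniform \<open>h\<close>.\<close>

lemma exists_uniformly_small_gap:
  assumes "0 < \<delta>"
  defines "D \<equiv> {d. 0 < d \<and> \<delta> \<le> measure V {d}}"
  shows "\<exists>h>0. \<forall>z\<in>{0..R}. measure V ({z<..<z + h} - D) < \<delta>"
proof -
  have "finite D"
    by (rule finite_subset[OF _ finite_large_atoms[OF assms(1)]]) (auto simp: D_def)
  then have D: "D \<in> sets borel" by (intro borel_closed finite_imp_closed)
  \<comment> \<open>The origin is left out as well: it may carry a large atom that is not in
    \<open>D\<close>, and the intervals to the right of \<open>z \<ge> 0\<close> miss it.\<close>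
  define P where "P = {0<..} - D"
  have P: "P \<in> sets borel" using D by (auto simp: P_def)
  have small_atom: "measure V ({z} \<inter> P) < \<delta>" for z
    using assms(1) by (cases "z \<in> P") (auto simp: P_def D_def)
  have "\<exists>r>0. measure V (ball z r \<inter> P) < \<delta>" for z
  proof -
    let ?S = "\<lambda>n. ball z (1 / real (Suc n)) \<inter> P"
    have "(\<lambda>n. measure V (?S n)) \<longlonglongrightarrow> measure V (\<Inter>n. ?S n)"
    proof (rule finite_Lim_measure_decseq)
      show "decseq ?S"
        by (intro decseq_SucI Int_mono subset_ball order_refl) (simp add: field_simps)
    qed (use P in \<open>auto simp: sets_eq_borel\<close>)
    moreover have "(\<Inter>n. ?S n) = {z} \<inter> P"
    proof -
      have "u = z" if "\<And>n. dist z u < 1 / real (Suc n)" for u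
      proof (rule ccontr)
        assume "u \<noteq> z"
        then obtain n where "inverse (real (Suc n)) < dist z u"
          using reals_Archimedean[of "dist z u"] by auto
        with that[of n] show False by (simp add: inverse_eq_divide)
      qed
      then show ?thesis by auto
    qed
    ultimately have "eventually (\<lambda>n. measure V (?S n) < \<delta>) sequentially"
      using order_tendstoD(2) small_atom by force
    then obtain n where "measure V (?S n) < \<delta>" by (auto simp: eventually_sequentially)
    then show ?thesis by (intro exI[of _ "1 / real (Suc n)"]) auto
  qed
  then obtain r where r: "0 < r z" "measure V (ball z (r z) \<inter> P) < \<delta>" for z by metis
  have cover: "{0..R} \<subseteq> (\<Union>z. ball z (r z))" using r(1) by (meson UN_I UNIV_I centre_in_ball subsetI)
  have "open B" if "B \<in> range (\<lambda>z. ball z (r z))" for B using that by auto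
  then obtain h where h: "0 < h"
    "\<forall>z\<in>{0..R}. \<exists>B\<in>range (\<lambda>z. ball z (r z)). ball z h \<subseteq> B"
    by (rule Heine_Borel_lemma[OF compact_Icc cover]) (assumption, rule that, assumption, blast)
  have "measure V ({z<..<z + h} - D) < \<delta>" if z: "z \<in> {0..R}" for z
  proof -
    obtain w where w: "ball z h \<subseteq> ball w (r w)" using bspec[OF h(2) z] by blast
    have "{z<..<z + h} - D \<subseteq> ball w (r w) \<inter> P"
      using w z by (auto simp: P_def dist_real_def subset_iff)
    then have "measure V ({z<..<z + h} - D) \<le> measure V (ball w (r w) \<inter> P)"
      using P by (intro finite_measure_mono) (auto simp: sets_eq_borel)
    with r(2)[of w] show ?thesis by linarith
  qed
  with h(1) show ?thesis by blast
qed

end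

lemma nonneg_distribution_distr:
  assumes "prob_space M" "X \<in> borel_measurable M" "AE \<omega> in M. 0 \<le> X \<omega>"
  shows "nonneg_distribution (distr M borel X)"
proof -
  interpret prob_space M by fact
  interpret D: prob_space "distr M borel X" using assms(2) by (rule prob_space_distr)
  have "AE \<omega> in M. \<not> X \<omega> < 0" using assms(3) by eventually_elim auto
  then have "emeasure M {\<omega> \<in> space M. X \<omega> < 0} = 0" by (rule emeasure_eq_0_AE)
  then have "measure M (X -` {..<0} \<inter> space M) = 0"
    by (simp add: measure_def vimage_def Int_def conj_commute)
  then show ?thesis
    using assms(2) by unfold_locales (simp_all add: measure_distr)
qed

section \<open>The law of a product\<close>

text \<open>Independence is encoded in \<open>H_eq\<close>, which takes the product measure as joint
  law; what follows concerns laws only.\<close>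

locale product_distribution = F: nonneg_distribution F + G: nonneg_distribution G
  for F G :: "real measure" +
  fixes H :: "real measure"
  assumes H_eq: "H = distr (F \<Otimes>\<^sub>M G) borel (\<lambda>p. fst p * snd p)"
    and subexp: "subexponential F"
    and G_nontrivial: "0 < tail G 0"
begin

sublocale FG: pair_prob_space F G ..

text \<open>Tonelli with the integral over \<open>G\<close> outermost: later arguments fix the
  weight \<open>y\<close> and estimate a probability under \<open>F\<close>.\<close>

lemma nn_integral_H:
  assumes [measurable]: "g \<in> borel_measurable borel"
  shows "(\<integral>\<^sup>+u. g u \<partial>H) = (\<integral>\<^sup>+y. \<integral>\<^sup>+a. g (a * y) \<partial>F \<partial>G)"
proof -
  have "(\<integral>\<^sup>+u. g u \<partial>H) = (\<integral>\<^sup>+p. g (fst p * snd p) \<partial>(F \<Otimes>\<^sub>M G))"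
    unfolding H_eq by (subst nn_integral_distr) auto
  also have "\<dots> = (\<integral>\<^sup>+y. \<integral>\<^sup>+a. g (a * y) \<partial>F \<partial>G)"
    by (subst FG.nn_integral_snd[symmetric]) (auto simp: case_prod_beta)
  finally show ?thesis .
qed

lemma emeasure_H:
  assumes "S \<in> sets borel"
  shows "emeasure H S = (\<integral>\<^sup>+y. emeasure F {a. a * y \<in> S} \<partial>G)"
proof -
  have "emeasure H S = (\<integral>\<^sup>+u. indicator S u \<partial>H)"
    using assms by (simp add: H_eq)
  also have "\<dots> = (\<integral>\<^sup>+y. \<integral>\<^sup>+a. indicator S (a * y) \<partial>F \<partial>G)"
    using assms by (intro nn_integral_H) auto
  also have "\<dots> = (\<integral>\<^sup>+y. emeasure F {a. a * y \<in> S} \<partial>G)"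
  proof (intro nn_integral_cong)
    fix y
    have "{a. a * y \<in> S} \<in> sets F"
      using measurable_sets[of "\<lambda>a. a * y" F borel S] assms by (simp add: vimage_def)
    moreover have "(\<integral>\<^sup>+a. indicator S (a * y) \<partial>F) = (\<integral>\<^sup>+a. indicator {a. a * y \<in> S} a \<partial>F)"
      by (intro nn_integral_cong) (simp add: indicator_def)
    ultimately show "(\<integral>\<^sup>+a. indicator S (a * y) \<partial>F) = emeasure F {a. a * y \<in> S}"
      by simp
  qed
  finally show ?thesis .
qed

sublocale H: nonneg_distribution H
proof -
  interpret H: prob_space H
    unfolding H_eq by (intro FG.prob_space_distr) auto
  have "AE y in G. emeasure F {a. a * y < 0} = 0"
    using G.AE_nonneg
  proof eventually_elim
    case (elim y)
    have "AE a in F. \<not> a * y < 0"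
      using F.AE_nonneg by eventually_elim (use elim in \<open>auto simp: mult_less_0_iff\<close>)
    then show ?case
      using emeasure_eq_0_AE[of "\<lambda>a. a * y < 0" F] by simp
  qed
  then have "emeasure H {..<0} = 0"
    by (subst emeasure_H) (auto simp: nn_integral_0_iff_AE cong: nn_integral_cong_AE)
  then show "nonneg_distribution H"
    by unfold_locales (simp_all add: H_eq measure_def)
qed

text \<open>Unlike \<open>tail F (t / y)\<close>, with which it agrees for \<open>y > 0\<close>, this is also right at \<open>y = 0\<close>,
  where \<open>t / y = 0\<close>.\<close>

definition exceed :: "real \<Rightarrow> real \<Rightarrow> ennreal" where
  "exceed t y = emeasure F {a. t < a * y}"

lemma exceed_pos: "0 < y \<Longrightarrow> exceed t y = ennreal (tail F (t / y))"
  unfolding exceed_def F.emeasure_greaterThan[symmetric]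
  by (intro arg_cong[where f = "emeasure F"]) (auto simp: field_simps)

lemma measurable_exceed [measurable]: "exceed t \<in> borel_measurable borel"
proof -
  have "(\<lambda>y. emeasure F (Pair y -` {p \<in> space (borel \<Otimes>\<^sub>M F). t < snd p * fst p})) \<in> borel_measurable borel"
    by (intro F.measurable_emeasure_Pair) measurable
  then show ?thesis by (simp add: exceed_def[abs_def] vimage_def space_pair_measure)
qed

lemma nn_integral_exceed: "(\<integral>\<^sup>+y. exceed t y \<partial>G) = ennreal (tail H t)"
  by (simp add: exceed_def emeasure_H flip: H.emeasure_greaterThan)

text \<open>Applying \<open>nn_integral_H\<close> to both copies integrates over \<open>y\<close>,
  \<open>a\<close>, \<open>z\<close>, \<open>b\<close> in this order; exchanging the middle two
  leaves a probability under two copies of \<open>F\<close> for fixed weights \<open>y\<close> and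
  \<open>z\<close>.\<close>

lemma emeasure_HH:
  assumes [measurable]: "S \<in> sets (borel \<Otimes>\<^sub>M borel)"
  shows "emeasure (H \<Otimes>\<^sub>M H) S =
    (\<integral>\<^sup>+y. \<integral>\<^sup>+z. emeasure (F \<Otimes>\<^sub>M F) {p. (fst p * y, snd p * z) \<in> S} \<partial>G \<partial>G)"
proof -
  let ?i = "\<lambda>u v. indicator S (u, v) :: ennreal"
  have [measurable]: "(\<lambda>p. ?i (f p) (g p)) \<in> borel_measurable N"
    if "f \<in> borel_measurable N" "g \<in> borel_measurable N" for f g and N :: "'b measure"
    using that by measurable
  have "emeasure (H \<Otimes>\<^sub>M H) S = (\<integral>\<^sup>+u. \<integral>\<^sup>+v. ?i u v \<partial>H \<partial>H)"
    by (intro H.emeasure_pair_measure) (simp add: H.VV_sets)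
  also have "\<dots> = (\<integral>\<^sup>+u. \<integral>\<^sup>+z. \<integral>\<^sup>+b. ?i u (b * z) \<partial>F \<partial>G \<partial>H)"
    by (intro nn_integral_cong nn_integral_H) measurable
  also have "\<dots> = (\<integral>\<^sup>+y. \<integral>\<^sup>+a. \<integral>\<^sup>+z. \<integral>\<^sup>+b. ?i (a * y) (b * z) \<partial>F \<partial>G \<partial>F \<partial>G)"
    by (intro nn_integral_H) measurable
  also have "\<dots> = (\<integral>\<^sup>+y. \<integral>\<^sup>+z. \<integral>\<^sup>+a. \<integral>\<^sup>+b. ?i (a * y) (b * z) \<partial>F \<partial>F \<partial>G \<partial>G)"
    by (intro nn_integral_cong FG.Fubini'[symmetric]) measurable
  also have "\<dots> = (\<integral>\<^sup>+y. \<integral>\<^sup>+z. emeasure (F \<Otimes>\<^sub>M F) {p. (fst p * y, snd p * z) \<in> S} \<partial>G \<partial>G)"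
  proof (intro nn_integral_cong)
    fix y z
    have "{p. (fst p * y, snd p * z) \<in> S} \<in> sets (F \<Otimes>\<^sub>M F)"
      by (intro F.VV_pred_sets) measurable
    then show "(\<integral>\<^sup>+a. \<integral>\<^sup>+b. ?i (a * y) (b * z) \<partial>F \<partial>F)
        = emeasure (F \<Otimes>\<^sub>M F) {p. (fst p * y, snd p * z) \<in> S}"
      by (subst F.emeasure_pair_measure) (auto simp: indicator_def intro!: nn_integral_cong)
  qed
  finally show ?thesis .
qed

text \<open>If \<open>Y > u\<close> and \<open>X > x / u\<close>, then \<open>X * Y > x\<close>.
  Choosing \<open>u\<close> suitably is how error terms are compared with
  \<open>tail H x\<close>.\<close>

lemma tail_H_ge:
  assumes "0 < u" "0 \<le> x"
  shows "tail G u * tail F (x / u) \<le> tail H x"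
proof -
  have "ennreal (tail G u * tail F (x / u)) = (\<integral>\<^sup>+y. ennreal (tail F (x / u)) * indicator {u<..} y \<partial>G)"
    by (subst nn_integral_cmult_indicator)
      (auto simp: G.sets_eq_borel G.emeasure_greaterThan ennreal_mult mult.commute)
  also have "\<dots> \<le> (\<integral>\<^sup>+y. exceed x y \<partial>G)"
  proof (intro nn_integral_mono)
    fix y
    have "tail F (x / u) \<le> tail F (x / y)" if "u < y"
      using that assms by (intro F.tail_antimono) (auto intro!: divide_left_mono)
    then show "ennreal (tail F (x / u)) * indicator {u<..} y \<le> exceed x y"
      using assms(1) by (auto simp: indicator_def exceed_pos)
  qed
  also have "\<dots> = ennreal (tail H x)" by (rule nn_integral_exceed)
  finally show ?thesis by simp
qed

lemma tail_F_pos: "0 < tail F x"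
  using F.subexponential_pos[OF subexp] .

lemma exists_tail_G_pos: "\<exists>u>0. 0 < tail G u"
proof (rule ccontr)
  assume "\<not> ?thesis"
  then have "tail G u \<le> 0" if "0 < u" for u
    using that by (meson not_less)
  then have "tail G u = 0" if "0 < u" for u
    using that by (intro antisym G.tail_nonneg)
  then have "emeasure G {u<..} = 0" if "0 < u" for u
    using that by (simp add: G.emeasure_greaterThan)
  then have "emeasure G (\<Union>n. {1 / real (Suc n)<..}) = 0"
    by (intro emeasure_UN_eq_0) (auto simp: G.sets_eq_borel)
  moreover have "(\<Union>n. {1 / real (Suc n)<..}) = {0<..}"
  proof (intro equalityI subsetI)
    fix u :: real assume "u \<in> {0<..}"
    then obtain n where "inverse (real (Suc n)) < u" using reals_Archimedean by auto
    then show "u \<in> (\<Union>n. {1 / real (Suc n)<..})" by (auto simp: inverse_eq_divide)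
  qed (auto intro: less_trans[rotated])
  ultimately show False using G_nontrivial by (simp add: G.emeasure_greaterThan)
qed

lemma tail_H_pos: "0 < tail H x"
proof -
  obtain u where u: "0 < u" "0 < tail G u" using exists_tail_G_pos by blast
  have "0 < tail G u * tail F (max x 0 / u)" using u tail_F_pos by simp
  also have "\<dots> \<le> tail H (max x 0)" using u by (intro tail_H_ge) auto
  also have "\<dots> \<le> tail H x" by (intro H.tail_antimono) auto
  finally show ?thesis .
qed

text \<open>For fixed weights \<open>y \<ge> z\<close> the event is covered by \<open>Q1\<close> to
  \<open>Q6\<close>. The set \<open>Q1\<close> is measured by \<open>joint_tail B (x / y)\<close>,
  and the others are rectangles or empty. Hence every term of the bound is a function of
  \<open>y\<close> times a function of \<open>z\<close>, ready for integration over independent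
  weights.\<close>

lemma joint_exceed_le:
  fixes \<epsilon> M B C C' A x y z :: real
  assumes B: "0 < B" "\<And>t. F.joint_tail B t \<le> \<epsilon> * tail F t"
    and M: "\<And>t. tail F (t - B) \<le> M * tail F t"
    and nn: "0 \<le> \<epsilon>" "0 \<le> M" "0 < C'" "0 \<le> A" "0 < x" "0 \<le> z" "z \<le> y"
  shows "emeasure (F \<Otimes>\<^sub>M F) {p. A < fst p * y \<and> A < snd p * z \<and> x < fst p * y + snd p * z}
    \<le> ennreal \<epsilon> * exceed x y + ennreal M * exceed x y * exceed A z
      + exceed A y * exceed (x - B * C) z + ennreal (tail F (x / (2 * C'))) * indicator {C<..} y
      + indicator {x / (2 * B)<..} y * exceed A z + ennreal M * exceed x y * indicator {C'<..} z"
    (is "emeasure ?N ?Q \<le> ?R")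
proof (cases "z = 0")
  \<comment> \<open>The second product is then 0 and cannot exceed \<open>A \<ge> 0\<close>, so the
    event is empty.\<close>
  case True
  then show ?thesis using nn by simp
next
  case False
  then have yz: "0 < z" "0 < y" using nn by auto
  let ?E = "\<lambda>t y. {a. t < a * y}"
  have E [measurable]: "?E t y \<in> sets F" for t y
    using measurable_sets[of "\<lambda>a. a * y" F borel "{t<..}"] by (simp add: vimage_def F.sets_eq_borel)
  have rect: "emeasure ?N (S \<times> T) = emeasure F S * emeasure F T" if "S \<in> sets F" "T \<in> sets F" for S T
    using F.emeasure_pair_measure_Times that by blast
  have UN: "UNIV \<in> sets F" "emeasure F UNIV = 1" 
    using F.emeasure_space_1 sets.top[of F] by simp_all
  define Q1 where "Q1 = {p. B < fst p \<and> B < snd p \<and> x / y < fst p + snd p}"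
  define Q2 where "Q2 = {x / y - B<..} \<times> ?E A z"
  define Q3 where "Q3 = ?E A y \<times> ?E (x - B * C) z"
  define Q4 where "Q4 = (if C < y then (UNIV :: real set) \<times> {x / (2 * C')<..} else {})"
  define Q5 where "Q5 = (if x / (2 * B) < y then (UNIV :: real set) \<times> ?E A z else {})"
  define Q6 where "Q6 = (if C' < z then (UNIV :: real set) \<times> {x / y - B<..} else {})"
  note defs = Q1_def Q2_def Q3_def Q4_def Q5_def Q6_def
  have Q: "Q1 \<in> sets ?N" "Q2 \<in> sets ?N" "Q3 \<in> sets ?N" "Q4 \<in> sets ?N" "Q5 \<in> sets ?N" "Q6 \<in> sets ?N"
    using F.VV_pred_sets[of "\<lambda>p. B < fst p \<and> B < snd p \<and> x / y < fst p + snd p"]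
    by (auto simp: Q1_def Q2_def Q3_def Q4_def Q5_def Q6_def UN F.sets_eq_borel)
  have shift: "ennreal (tail F (x / y - B)) \<le> ennreal M * exceed x y"
    using M[of "x / y"] nn yz by (simp add: exceed_pos flip: ennreal_mult)
  have m1: "emeasure ?N Q1 \<le> ennreal \<epsilon> * exceed x y"
    using B(2)[of "x / y"] nn yz
    by (simp add: Q1_def F.joint_tail_def exceed_pos F.VV.emeasure_eq_measure flip: ennreal_mult)
  have m2: "emeasure ?N Q2 \<le> ennreal M * exceed x y * exceed A z"
    using shift by (simp add: Q2_def rect E F.sets_eq_borel F.emeasure_greaterThan exceed_def mult_right_mono)
  have m3: "emeasure ?N Q3 \<le> exceed A y * exceed (x - B * C) z"
    by (simp add: Q3_def rect E exceed_def)
  have m4: "emeasure ?N Q4 \<le> ennreal (tail F (x / (2 * C'))) * indicator {C<..} y"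
    by (simp add: Q4_def rect UN F.sets_eq_borel F.emeasure_greaterThan)
  have m5: "emeasure ?N Q5 \<le> indicator {x / (2 * B)<..} y * exceed A z"
    by (simp add: Q5_def rect UN E exceed_def)
  have m6: "emeasure ?N Q6 \<le> ennreal M * exceed x y * indicator {C'<..} z"
    using shift by (simp add: Q6_def rect UN F.sets_eq_borel F.emeasure_greaterThan)
  have "?Q \<subseteq> Q1 \<union> Q2 \<union> Q3 \<union> Q4 \<union> Q5 \<union> Q6"
  proof (rule subsetI, rule ccontr)
    fix p assume p: "p \<in> ?Q" and n: "p \<notin> Q1 \<union> Q2 \<union> Q3 \<union> Q4 \<union> Q5 \<union> Q6"
    obtain a b where "p = (a, b)" by (cases p)
    then have ab: "A < a * y" "A < b * z" "x < a * y + b * z"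
      and n6: "(a, b) \<notin> Q6" and n5: "(a, b) \<notin> Q5" and n4: "(a, b) \<notin> Q4" and n3: "(a, b) \<notin> Q3"
      and n2: "(a, b) \<notin> Q2" and n1: "(a, b) \<notin> Q1" using p n by auto
    have b: "0 < b" using ab(2) nn(4) yz by (metis less_le_trans not_le_imp_less zero_less_mult_pos2 le_less_trans)
    have bzy: "b * z \<le> b * y" using b nn by (intro mult_left_mono) auto
    \<comment> \<open>Suppose \<open>a > B\<close>. If \<open>b * z \<le> B * y\<close>, then
      \<open>a\<close> alone exceeds \<open>x / y - B\<close>, which is \<open>Q2\<close>; otherwise
      \<open>z \<le> y\<close> gives \<open>b > B\<close> and \<open>a + b > x / y\<close>, which is
      \<open>Q1\<close>.\<close>
    have "a \<le> B"
    proof (rule ccontr)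
      assume "\<not> a \<le> B"
      show False
      proof (cases "b * z \<le> B * y")
        case True
        then have "x / y - B < a" using ab yz by (simp add: field_simps)
        with n2 ab show False by (simp add: Q2_def)
      next
        case False
        then have "B * y < b * y" using bzy by simp
        then have "B < b" using yz by simp
        moreover have "x / y < a + b" using ab bzy yz by (simp add: field_simps)
        ultimately show False using n1 \<open>\<not> a \<le> B\<close> by (simp add: Q1_def)
      qed
    qed
    then have ayB: "a * y \<le> B * y" using yz by simp
    \<comment> \<open>A weight \<open>y \<le> C\<close> would cap the first product at
      \<open>B * C\<close> and leave more than \<open>x - B * C\<close> to the second, which is
      \<open>Q3\<close>.\<close>
    have "C < y"
    proof (rule ccontr)
      assume "\<not> C < y"
      then have "B * y \<le> B * C" using B(1) by simp
      then have "x - B * C < b * z" using ab ayB by linarith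
      with n3 ab show False by (simp add: Q3_def)
    qed
    \<comment> \<open>Now \<open>b > x / y - B\<close>, so avoiding \<open>Q6\<close> forces
      \<open>z \<le> C'\<close>. Avoiding \<open>Q5\<close> caps the first product at
      \<open>x / 2\<close>, so the second exceeds \<open>x / 2\<close> and
      \<open>b > x / (2 * C')\<close>, which is \<open>Q4\<close>.\<close>
    have "x < B * y + b * y" using ab ayB bzy by linarith
    then have "x / y - B < b" using yz by (simp add: field_simps)
    then have "z \<le> C'" using n6 by (auto simp: Q6_def split: if_splits)
    have "y \<le> x / (2 * B)" using n5 ab by (auto simp: Q5_def split: if_splits)
    then have "B * y \<le> x / 2" using B(1) by (simp add: field_simps)
    then have "x / 2 < b * z" using ab ayB by linarith
    also have "\<dots> \<le> b * C'" using b \<open>z \<le> C'\<close> by simp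
    finally have "x / (2 * C') < b" using nn(3) by (simp add: field_simps)
    with n4 \<open>C < y\<close> show False by (simp add: Q4_def)
  qed
  then have "emeasure ?N ?Q \<le> emeasure ?N (Q1 \<union> Q2 \<union> Q3 \<union> Q4 \<union> Q5 \<union> Q6)"
    using Q by (intro emeasure_mono) auto
  also have "\<dots> \<le> emeasure ?N Q1 + emeasure ?N Q2 + emeasure ?N Q3 + emeasure ?N Q4 + emeasure ?N Q5 + emeasure ?N Q6"
    using Q by (intro order_trans[OF emeasure_subadditive] add_right_mono emeasure_subadditive) auto
  also have "\<dots> \<le> ?R"
    by (intro add_mono m1 m2 m3 m4 m5 m6)
  finally show ?thesis .
qed

section \<open>Joint exceedance of two independent products\<close>

text \<open>Exchangeability of the two copies, which reduces arbitrary weights to the case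
  \<open>z \<le> y\<close>.\<close>

lemma emeasure_FF_swap:
  assumes "Measurable.pred (borel \<Otimes>\<^sub>M borel) (\<lambda>p. P (fst p) (snd p))"
  shows "emeasure (F \<Otimes>\<^sub>M F) {p. P (snd p) (fst p)} = emeasure (F \<Otimes>\<^sub>M F) {p. P (fst p) (snd p)}"
proof -
  have "{p. P (fst p) (snd p)} \<in> sets (F \<Otimes>\<^sub>M F)"
    using F.VV_pred_sets[OF assms] .
  then have "emeasure (distr (F \<Otimes>\<^sub>M F) (F \<Otimes>\<^sub>M F) (\<lambda>(x, y). (y, x))) {p. P (fst p) (snd p)}
      = emeasure (F \<Otimes>\<^sub>M F) {p. P (snd p) (fst p)}"
    by (subst emeasure_distr) (auto simp: vimage_def case_prod_beta space_pair_measure measurable_pair_swap')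
  then show ?thesis
    using F.VV.distr_pair_swap by simp
qed

lemma nn_integral_indicator_greaterThan: "(\<integral>\<^sup>+y. indicator {c<..} y \<partial>G) = ennreal (tail G c)"
  by (simp add: G.sets_eq_borel G.emeasure_greaterThan)

text \<open>The pointwise bound \<open>R y z\<close> covers \<open>z \<le> y\<close>, and by
  symmetry \<open>R z y\<close> covers the other case; adding both accounts for the factor 2.
  Integration over the weights turns each \<open>exceed\<close> into a tail of \<open>H\<close> and
  each indicator into a tail of \<open>G\<close>.\<close>

lemma joint_tail_H_le:
  fixes \<epsilon> M B C C' A x :: real
  assumes B: "0 < B" "\<And>t. F.joint_tail B t \<le> \<epsilon> * tail F t"
    and M: "\<And>t. tail F (t - B) \<le> M * tail F t"
    and nn: "0 \<le> \<epsilon>" "0 \<le> M" "0 < C'" "0 \<le> A" "0 < x"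
  shows "H.joint_tail A x \<le> 2 * (\<epsilon> * tail H x + M * tail H x * tail H A
      + tail H A * tail H (x - B * C) + tail F (x / (2 * C')) * tail G C
      + tail G (x / (2 * B)) * tail H A + M * tail H x * tail G C')" (is "_ \<le> 2 * ?r")
proof -
  define R where "R = (\<lambda>y z. ennreal \<epsilon> * exceed x y + ennreal M * exceed x y * exceed A z
      + exceed A y * exceed (x - B * C) z + ennreal (tail F (x / (2 * C'))) * indicator {C<..} y
      + indicator {x / (2 * B)<..} y * exceed A z + ennreal M * exceed x y * indicator {C'<..} z)"
  have R_meas: "case_prod R \<in> borel_measurable (G \<Otimes>\<^sub>M G)"
    unfolding R_def by measurable
  have R_meas' [measurable]: "R y \<in> borel_measurable borel" "(\<lambda>y. R y z) \<in> borel_measurable borel" for y z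
    unfolding R_def by measurable
  define q where "q = (\<lambda>y z. emeasure (F \<Otimes>\<^sub>M F)
    {p. A < fst p * y \<and> A < snd p * z \<and> x < fst p * y + snd p * z})"
  have q_swap: "q y z = q z y" for y z
    using emeasure_FF_swap[of "\<lambda>a b. A < a * z \<and> A < b * y \<and> x < a * z + b * y"]
    by (simp add: q_def conj_ac add.commute)
  have q_le: "q y z \<le> R y z + R z y" if "0 \<le> y" "0 \<le> z" for y z
  proof (cases "z \<le> y")
    case True
    have "q y z \<le> R y z"
      unfolding q_def R_def by (rule joint_exceed_le) (use assms that True in auto)
    then show ?thesis by (rule order_trans) simp
  next
    case False
    have "q z y \<le> R z y"
      unfolding q_def R_def by (rule joint_exceed_le) (use assms that False in auto)
    then show ?thesis unfolding q_swap[of y z] by (rule order_trans) simp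
  qed
  have "(\<integral>\<^sup>+y. \<integral>\<^sup>+z. R y z \<partial>G \<partial>G) = (\<integral>\<^sup>+y. ennreal \<epsilon> * exceed x y + ennreal M * exceed x y * ennreal (tail H A)
      + exceed A y * ennreal (tail H (x - B * C)) + ennreal (tail F (x / (2 * C'))) * indicator {C<..} y
      + indicator {x / (2 * B)<..} y * ennreal (tail H A) + ennreal M * exceed x y * ennreal (tail G C') \<partial>G)"
    unfolding R_def
    by (intro nn_integral_cong)
      (simp add: nn_integral_add nn_integral_cmult nn_integral_exceed nn_integral_indicator_greaterThan
        G.emeasure_space_1[simplified] del: nn_integral_indicator)
  also have "\<dots> = ennreal \<epsilon> * ennreal (tail H x) + ennreal M * ennreal (tail H x) * ennreal (tail H A)
      + ennreal (tail H A) * ennreal (tail H (x - B * C)) + ennreal (tail F (x / (2 * C'))) * ennreal (tail G C)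
      + ennreal (tail G (x / (2 * B))) * ennreal (tail H A) + ennreal M * ennreal (tail H x) * ennreal (tail G C')"
    by (simp add: nn_integral_add nn_integral_cmult nn_integral_multc nn_integral_exceed
        nn_integral_indicator_greaterThan mult.assoc del: nn_integral_indicator)
  also have "\<dots> = ennreal ?r"
    using nn by (simp add: ennreal_mult)
  finally have R_int: "(\<integral>\<^sup>+y. \<integral>\<^sup>+z. R y z \<partial>G \<partial>G) = ennreal ?r" .
  have R_int': "(\<integral>\<^sup>+y. \<integral>\<^sup>+z. R z y \<partial>G \<partial>G) = ennreal ?r"
    using G.VV.Fubini'[OF R_meas] R_int by simp
  have "emeasure (H \<Otimes>\<^sub>M H) {p. A < fst p \<and> A < snd p \<and> x < fst p + snd p}
      = (\<integral>\<^sup>+y. \<integral>\<^sup>+z. q y z \<partial>G \<partial>G)"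
    unfolding q_def
    using H.VV_pred_sets[of "\<lambda>p. A < fst p \<and> A < snd p \<and> x < fst p + snd p"]
    by (subst emeasure_HH) (simp_all add: H.VV_sets)
  also have "\<dots> \<le> (\<integral>\<^sup>+y. \<integral>\<^sup>+z. R y z + R z y \<partial>G \<partial>G)"
  proof (rule nn_integral_mono_AE)
    show "AE y in G. (\<integral>\<^sup>+z. q y z \<partial>G) \<le> (\<integral>\<^sup>+z. R y z + R z y \<partial>G)"
      using G.AE_nonneg
    proof eventually_elim
      case (elim y)
      show ?case
        by (intro nn_integral_mono_AE) (use G.AE_nonneg elim q_le in auto)
    qed
  qed
  also have "\<dots> = (\<integral>\<^sup>+y. (\<integral>\<^sup>+z. R y z \<partial>G) + (\<integral>\<^sup>+z. R z y \<partial>G) \<partial>G)"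
    by (intro nn_integral_cong nn_integral_add) measurable
  also have "\<dots> = (\<integral>\<^sup>+y. \<integral>\<^sup>+z. R y z \<partial>G \<partial>G) + (\<integral>\<^sup>+y. \<integral>\<^sup>+z. R z y \<partial>G \<partial>G)"
    unfolding R_def by (intro nn_integral_add) measurable
  also have "\<dots> = ennreal (2 * ?r)"
    using nn by (simp add: R_int R_int' flip: ennreal_plus)
  finally have "ennreal (H.joint_tail A x) \<le> ennreal (2 * ?r)"
    by (simp only: H.joint_tail_def H.VV.emeasure_eq_measure)
  moreover have "0 \<le> 2 * ?r" using nn by simp
  ultimately show ?thesis by (simp only: ennreal_le_iff)
qed

lemma subexponential_H_if_long_tailed:
  assumes long: H.long_tailed
  shows "subexponential H"
proof (rule H.subexponentialI[OF tail_H_pos long])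
  fix \<epsilon>' :: real assume "0 < \<epsilon>'"
  define \<epsilon> where "\<epsilon> = \<epsilon>' / 8"
  have \<epsilon>: "0 < \<epsilon>" using \<open>0 < \<epsilon>'\<close> by (simp add: \<epsilon>_def)
  \<comment> \<open>The order of choice matters: \<open>M\<close> depends on \<open>B\<close>,
    \<open>C'\<close> on \<open>M\<close>, \<open>C\<close> on \<open>C'\<close>, and
    \<open>A\<close> comes last, after all constants that multiply \<open>tail H A\<close>.\<close>
  obtain B where B: "0 < B" "\<And>t. F.joint_tail B t \<le> \<epsilon> * tail F t"
    using F.exists_joint_tail_le[OF subexp \<epsilon>] by blast
  obtain M where M: "0 < M" "\<And>t. tail F (t - B) \<le> M * tail F t"
    using F.exists_shift_bound[OF tail_F_pos F.long_tailedD, of 1 B]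
      F.subexponential_imp_long_tailed[OF subexp] by auto
  obtain C' where C': "1 \<le> C'" "tail G C' < \<epsilon> / M"
    using G.ex_tail_less[of "\<epsilon> / M" 1] \<epsilon> M(1) by auto
  \<comment> \<open>Smallness relative to \<open>tail G (2 * C')\<close> lets
    \<open>tail_H_ge\<close> at \<open>u = 2 * C'\<close> absorb the term with
    \<open>tail F (x / (2 * C'))\<close>. If that tail of \<open>G\<close> vanishes,
    \<open>2 * C'\<close> itself serves.\<close>
  obtain C where C: "tail G C \<le> \<epsilon> * tail G (2 * C')"
  proof (cases "tail G (2 * C') = 0")
    case True
    then show ?thesis using that[of "2 * C'"] by simp
  next
    case False
    then have "0 < \<epsilon> * tail G (2 * C')"
      using \<epsilon> G.tail_nonneg[of "2 * C'"] by (simp add: less_le)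
    then obtain c where "tail G c < \<epsilon> * tail G (2 * C')" using G.ex_tail_less by blast
    then show ?thesis by (intro that[of c]) simp
  qed
  \<comment> \<open>Collects the coefficients of \<open>tail H x * tail H A\<close>:
    \<open>M\<close> from the shift of \<open>F\<close>, 2 from the shift of \<open>H\<close> by
    \<open>B * C\<close>, and the last from \<open>tail_H_ge\<close> at
    \<open>u = x / (2 * B)\<close>.\<close>
  define L where "L = M + 2 + 1 / tail F (2 * B)"
  have L: "0 < L" using M(1) tail_F_pos by (simp add: L_def add_pos_pos)
  obtain A where A: "0 \<le> A" "tail H A < \<epsilon> / L"
    using H.ex_tail_less[of "\<epsilon> / L" 0] \<epsilon> L by auto
  have "eventually (\<lambda>x. H.joint_tail A x \<le> \<epsilon>' * tail H x) at_top"
    using H.long_tailedD[OF long zero_less_one, of "B * C"] eventually_gt_at_top[of 0]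
  proof eventually_elim
    case (elim x)
    have t1: "tail F (x / (2 * C')) * tail G C \<le> \<epsilon> * tail H x"
    proof -
      have "tail F (x / (2 * C')) * tail G C \<le> tail F (x / (2 * C')) * (\<epsilon> * tail G (2 * C'))"
        using C by (intro mult_left_mono) auto
      also have "\<dots> = \<epsilon> * (tail G (2 * C') * tail F (x / (2 * C')))" by simp
      also have "\<dots> \<le> \<epsilon> * tail H x"
        using \<epsilon> C' elim by (intro mult_left_mono tail_H_ge) auto
      finally show ?thesis .
    qed
    have t2: "tail G (x / (2 * B)) * tail H A \<le> tail H x * (1 / tail F (2 * B)) * tail H A"
    proof (intro mult_right_mono)
      have "tail G (x / (2 * B)) * tail F (x / (x / (2 * B))) \<le> tail H x"
        using B(1) elim by (intro tail_H_ge) auto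
      then show "tail G (x / (2 * B)) \<le> tail H x * (1 / tail F (2 * B))"
        using elim tail_F_pos[of "2 * B"] by (simp add: field_simps)
    qed simp
    have t3: "tail H A * tail H (x - B * C) \<le> tail H A * (2 * tail H x)"
      using elim by (intro mult_left_mono) auto
    have t4: "M * tail H x * tail G C' \<le> M * tail H x * (\<epsilon> / M)"
      using C' M(1) by (intro mult_left_mono) auto
    then have t4: "M * tail H x * tail G C' \<le> \<epsilon> * tail H x"
      using M(1) by (simp add: mult.commute)
    have t5: "L * tail H x * tail H A \<le> L * tail H x * (\<epsilon> / L)"
      using A L by (intro mult_left_mono) auto
    then have t5: "L * tail H x * tail H A \<le> \<epsilon> * tail H x"
      using L by (simp add: mult.commute)
    \<comment> \<open>The three terms with \<open>tail H A\<close> together cost at most one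
      \<open>e\<close>, the other three cost one \<open>e\<close> each, and the factor 2 makes this
      \<open>8 * e\<close>.\<close>
    have arith: "j \<le> 8 * e" if "l = a + b' + d'" "j \<le> 2 * (e + a + b + c + d + g)"
      "c \<le> e" "d \<le> d'" "b \<le> b'" "g \<le> e" "l \<le> e" for j e l a b b' c d d' g :: real
      using that by argo
    have L_eq: "L * tail H x * tail H A = M * tail H x * tail H A + tail H A * (2 * tail H x)
        + tail H x * (1 / tail F (2 * B)) * tail H A"
      by (simp add: L_def algebra_simps)
    have J: "H.joint_tail A x \<le> 2 * (\<epsilon> * tail H x + M * tail H x * tail H A
      + tail H A * tail H (x - B * C) + tail F (x / (2 * C')) * tail G C
      + tail G (x / (2 * B)) * tail H A + M * tail H x * tail G C')"
      using B M C' A elim \<epsilon> by (intro joint_tail_H_le) auto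
    have "H.joint_tail A x \<le> 8 * (\<epsilon> * tail H x)"
      by (rule arith[OF L_eq J t1 t2 t3 t4 t5])
    then show ?case by (simp add: \<epsilon>_def)
  qed
  then show "\<exists>A. eventually (\<lambda>x. H.joint_tail A x \<le> \<epsilon>' * tail H x) at_top" by blast
qed

section \<open>Long tails of products\<close>

lemma diff_tail_H_eq:
  "ennreal (tail H x - tail H (x + 1)) = (\<integral>\<^sup>+y. emeasure F {a. x < a * y \<and> a * y \<le> x + 1} \<partial>G)"
proof -
  have "ennreal (tail H x - tail H (x + 1)) = emeasure H {x<..x + 1}"
    by (simp add: H.tail_diff H.emeasure_eq_measure)
  then show ?thesis by (simp add: emeasure_H)
qed

lemma nn_integral_indicator_Ioc:
  assumes "0 < d"
  shows "(\<integral>\<^sup>+y. indicator {x / d<..(x + 1) / d} y \<partial>G) = ennreal (tail G (x / d) - tail G ((x + 1) / d))"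
  using assms by (simp add: G.tail_diff divide_right_mono G.sets_eq_borel G.emeasure_eq_measure)

text \<open>The left side is the probability that \<open>X = d\<close> and
  \<open>x < d * Y \<le> x + 1\<close>, an event contained in
  \<open>x < X * Y \<le> x + 1\<close>.\<close>

lemma atom_diff_le:
  assumes "0 < d"
  shows "measure F {d} * (tail G (x / d) - tail G ((x + 1) / d)) \<le> tail H x - tail H (x + 1)"
proof -
  have "ennreal (measure F {d} * (tail G (x / d) - tail G ((x + 1) / d)))
      = (\<integral>\<^sup>+y. emeasure F {d} * indicator {x / d<..(x + 1) / d} y \<partial>G)"
    using assms
    by (simp add: nn_integral_cmult nn_integral_indicator_Ioc F.emeasure_eq_measure ennreal_mult'
        G.sets_eq_borel del: nn_integral_indicator)
  also have "\<dots> \<le> (\<integral>\<^sup>+y. emeasure F {a. x < a * y \<and> a * y \<le> x + 1} \<partial>G)"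
  proof (intro nn_integral_mono)
    fix y
    have "{a. x < a * y \<and> a * y \<le> x + 1} \<in> sets F"
      using measurable_sets[of "\<lambda>a. a * y" F borel "{x<..x + 1}"]
      by (simp add: vimage_def F.sets_eq_borel)
    then show "emeasure F {d} * indicator {x / d<..(x + 1) / d} y
        \<le> emeasure F {a. x < a * y \<and> a * y \<le> x + 1}"
      using assms by (auto simp: indicator_def field_simps intro!: emeasure_mono)
  qed
  also have "\<dots> = ennreal (tail H x - tail H (x + 1))" by (rule diff_tail_H_eq[symmetric])
  finally show ?thesis
    by (simp add: H.tail_antimono)
qed

lemma atom_condition_if_long_tailed:
  assumes H.long_tailed "0 < d" "0 < measure F {d}"
  shows "(\<lambda>x. tail G (x / d) - tail G ((x + 1) / d)) \<in> o[at_top](tail H)"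
proof (rule landau_o.smallI)
  fix c :: real assume "0 < c"
  have "eventually (\<lambda>x. tail H x - tail H (x + 1) \<le> c * measure F {d} * tail H x) at_top"
    using assms \<open>0 < c\<close> by (intro H.long_tailed_diff) auto
  then show "eventually (\<lambda>x. norm (tail G (x / d) - tail G ((x + 1) / d)) \<le> c * norm (tail H x)) at_top"
  proof eventually_elim
    case (elim x)
    have "0 \<le> tail G (x / d) - tail G ((x + 1) / d)"
      using assms(2) by (simp add: G.tail_antimono divide_right_mono)
    moreover have "measure F {d} * (tail G (x / d) - tail G ((x + 1) / d)) \<le> measure F {d} * (c * tail H x)"
      using atom_diff_le[OF assms(2), of x] elim by (simp add: mult_ac)
    ultimately show ?case using assms(3) by simp
  qed
qed

text \<open>For \<open>y < \<epsilon>\<close> the window of length \<open>1 / y\<close> may be long,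
  so the whole tail is kept, at most \<open>tail F (x / u)\<close>. For
  \<open>\<epsilon> \<le> y \<le> x / K\<close> the window has length at most
  \<open>1 / \<epsilon>\<close> and starts at or beyond \<open>K\<close>, so \<open>long\<close>
  applies. For \<open>y > x / K\<close> it starts in \<open>[0, K]\<close> and is shorter than
  \<open>h\<close>: large atoms are charged to the sum over \<open>D\<close>, and the rest has mass
  below \<open>\<delta>\<close>.\<close>

lemma diff_pointwise_le:
  fixes K h \<delta> \<eta> \<epsilon> u x y :: real
  assumes "0 < \<epsilon>" "\<epsilon> \<le> u" "0 < K" "0 \<le> \<eta>" "0 < \<delta>" "0 < x" "K < h * x" "0 < y"
    and D: "D = {d. 0 < d \<and> \<delta> \<le> measure F {d}}"
    and gap: "\<forall>z\<in>{0..K}. measure F ({z<..<z + h} - D) < \<delta>"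
    and long: "\<And>t. K \<le> t \<Longrightarrow> tail F t - tail F (t + 1 / \<epsilon>) \<le> \<eta> * tail F t"
  shows "emeasure F {a. x < a * y \<and> a * y \<le> x + 1}
    \<le> ennreal (tail F (x / u)) * indicator {0<..<\<epsilon>} y + ennreal \<eta> * exceed x y
      + (\<Sum>d\<in>D. indicator {x / d<..(x + 1) / d} y) + ennreal \<delta> * indicator {x / K<..} y"
    (is "?m \<le> ?t1 + ?t2 + ?t3 + ?t4")
proof -
  have finD: "finite D"
    unfolding D by (rule finite_subset[OF _ F.finite_large_atoms[OF assms(5)]]) auto
  have Seq: "{a. x < a * y \<and> a * y \<le> x + 1} = {x / y<..(x + 1) / y}"
    using assms(8) by (auto simp: field_simps)
  have diff: "?m = ennreal (tail F (x / y) - tail F (x / y + 1 / y))"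
    unfolding Seq using assms(8)
    by (simp add: F.tail_diff F.emeasure_eq_measure add_divide_distrib)
  consider "y < \<epsilon>" | "\<epsilon> \<le> y" "y \<le> x / K" | "x / K < y" by linarith
  then show ?thesis
  proof cases
    case 1
    have "tail F (x / y) \<le> tail F (x / u)"
      using assms 1 by (intro F.tail_antimono divide_left_mono) auto
    then have "?m \<le> ennreal (tail F (x / u))"
      unfolding diff by (intro ennreal_leI) (use F.tail_nonneg[of "x / y + 1 / y"] in linarith)
    then have "?m \<le> ?t1" using 1 assms(8) by simp
    also have "?t1 \<le> ?t1 + (?t2 + (?t3 + ?t4))" by (rule add_increasing2) auto
    finally show ?thesis by (simp only: add.assoc)
  next
    case 2
    have "tail F (x / y + 1 / \<epsilon>) \<le> tail F (x / y + 1 / y)"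
      using assms 2 by (intro F.tail_antimono add_left_mono divide_left_mono) auto
    moreover have "K \<le> x / y" using 2 assms by (simp add: field_simps)
    ultimately have "tail F (x / y) - tail F (x / y + 1 / y) \<le> \<eta> * tail F (x / y)"
      using long[of "x / y"] by linarith
    then have "?m \<le> ?t2"
      unfolding diff using assms by (simp add: exceed_pos ennreal_leI flip: ennreal_mult)
    then show ?thesis by (meson add_increasing add_increasing2 zero_le)
  next
    case 3
    have xyK: "x / y < K" using 3 assms by (simp add: field_simps)
    have "1 / y < h"
    proof -
      have "x < K * y" using 3 assms by (simp add: field_simps)
      also have "\<dots> < h * x * y" using assms by simp
      finally have "x * 1 < x * (h * y)" by (simp add: mult_ac)
      then have "1 < h * y" using assms(6) by (simp only: mult_less_cancel_left_pos)
      then show ?thesis using assms by (simp add: field_simps)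
    qed
    then have sub: "{x / y<..(x + 1) / y} \<subseteq> ({x / y<..<x / y + h} - D) \<union> {a\<in>D. x < a * y \<and> a * y \<le> x + 1}"
      using Seq by (auto simp: add_divide_distrib)
    have meas: "{x / y<..<x / y + h} - D \<in> sets F" "{a\<in>D. x < a * y \<and> a * y \<le> x + 1} \<in> sets F"
      using finD by (simp_all add: F.sets_eq_borel sets.Diff borel_closed finite_imp_closed)
    have "emeasure F {a\<in>D. x < a * y \<and> a * y \<le> x + 1} \<le> ?t3"
    proof (cases "{a\<in>D. x < a * y \<and> a * y \<le> x + 1} = {}")
      case True
      show ?thesis unfolding True by simp
    next
      case False
      then obtain d where d: "d \<in> D" "x < d * y" "d * y \<le> x + 1" by auto
      \<comment> \<open>One atom \<open>d\<close> in the window puts \<open>y\<close> into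
        \<open>(x / d, (x + 1) / d]\<close>, so a single indicator already dominates any
        probability.\<close>
      have "emeasure F {a\<in>D. x < a * y \<and> a * y \<le> x + 1} \<le> 1" by (rule F.measure_le_1)
      also have "(1 :: ennreal) = indicator {x / d<..(x + 1) / d} y"
        using d by (auto simp: D indicator_def field_simps)
      also have "\<dots> \<le> ?t3" using finD d(1) by (intro member_le_sum) auto
      finally show ?thesis .
    qed
    moreover have "emeasure F ({x / y<..<x / y + h} - D) \<le> ?t4"
    proof -
      have "measure F ({x / y<..<x / y + h} - D) < \<delta>"
        using gap xyK assms by auto
      then show ?thesis using 3 by (simp add: F.emeasure_eq_measure ennreal_leI)
    qed
    moreover have "?m \<le> emeasure F ({x / y<..<x / y + h} - D) + emeasure F {a\<in>D. x < a * y \<and> a * y \<le> x + 1}"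
      unfolding Seq using sub meas by (intro order_trans[OF emeasure_mono emeasure_subadditive]) auto
    ultimately have "?m \<le> ?t4 + ?t3" by (meson add_mono order_trans)
    also have "?t4 + ?t3 = ?t3 + ?t4" by (rule add.commute)
    also have "\<dots> \<le> (?t1 + ?t2) + (?t3 + ?t4)" by (rule add_increasing) auto
    finally show ?thesis by (simp only: add.assoc)
  qed
qed

text \<open>The pointwise bound is integrated over \<open>y\<close>. The weight \<open>y = 0\<close>
  contributes nothing because \<open>x > 0\<close>, so a possible atom of \<open>G\<close> at 0
  stays out of \<open>{0<..<\<epsilon>}\<close>.\<close>

lemma diff_tail_H_le:
  fixes K h \<delta> \<eta> \<epsilon> u x :: real
  assumes "0 < \<epsilon>" "\<epsilon> \<le> u" "0 < K" "0 \<le> \<eta>" "0 < \<delta>" "0 < x" "K < h * x"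
    and D: "D = {d. 0 < d \<and> \<delta> \<le> measure F {d}}"
    and gap: "\<forall>z\<in>{0..K}. measure F ({z<..<z + h} - D) < \<delta>"
    and long: "\<And>t. K \<le> t \<Longrightarrow> tail F t - tail F (t + 1 / \<epsilon>) \<le> \<eta> * tail F t"
  shows "tail H x - tail H (x + 1)
    \<le> tail F (x / u) * measure G {0<..<\<epsilon>} + \<eta> * tail H x
      + (\<Sum>d\<in>D. tail G (x / d) - tail G ((x + 1) / d)) + \<delta> * tail G (x / K)" (is "_ \<le> ?r")
proof -
  have D0: "0 < d" if "d \<in> D" for d using that D by simp
  have sum_nonneg: "0 \<le> (\<Sum>d\<in>D. tail G (x / d) - tail G ((x + 1) / d))"
    by (intro sum_nonneg) (auto dest!: D0 intro!: G.tail_antimono divide_right_mono)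
  have "ennreal (tail H x - tail H (x + 1)) = (\<integral>\<^sup>+y. emeasure F {a. x < a * y \<and> a * y \<le> x + 1} \<partial>G)"
    by (rule diff_tail_H_eq)
  also have "\<dots> \<le> (\<integral>\<^sup>+y. ennreal (tail F (x / u)) * indicator {0<..<\<epsilon>} y + ennreal \<eta> * exceed x y
      + (\<Sum>d\<in>D. indicator {x / d<..(x + 1) / d} y) + ennreal \<delta> * indicator {x / K<..} y \<partial>G)"
  proof (rule nn_integral_mono_AE, use G.AE_nonneg in eventually_elim)
    case (elim y)
    then consider "y = 0" | "0 < y" by linarith
    then show ?case
    proof cases
      case 1
      then have empty: "{a. x < a * y \<and> a * y \<le> x + 1} = {}" using assms(6) by auto
      show ?thesis unfolding empty by simp
    next
      case 2
      then show ?thesis using assms by (intro diff_pointwise_le) auto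
    qed
  qed
  also have "\<dots> = ennreal (tail F (x / u)) * ennreal (measure G {0<..<\<epsilon>}) + ennreal \<eta> * ennreal (tail H x)
      + (\<Sum>d\<in>D. ennreal (tail G (x / d) - tail G ((x + 1) / d))) + ennreal \<delta> * ennreal (tail G (x / K))"
  proof -
    have "(\<integral>\<^sup>+y. (\<Sum>d\<in>D. indicator {x / d<..(x + 1) / d} y) \<partial>G)
        = (\<Sum>d\<in>D. ennreal (tail G (x / d) - tail G ((x + 1) / d)))"
    proof (subst nn_integral_sum)
      show "(\<Sum>d\<in>D. \<integral>\<^sup>+y. indicator {x / d<..(x + 1) / d} y \<partial>G)
          = (\<Sum>d\<in>D. ennreal (tail G (x / d) - tail G ((x + 1) / d)))"
        by (intro sum.cong refl nn_integral_indicator_Ioc D0)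
    qed simp
    moreover have "(\<integral>\<^sup>+y. indicator {0<..<\<epsilon>} y \<partial>G) = ennreal (measure G {0<..<\<epsilon>})"
      by (simp add: G.sets_eq_borel G.emeasure_eq_measure)
    ultimately show ?thesis
      by (simp add: nn_integral_add nn_integral_cmult nn_integral_exceed nn_integral_indicator_greaterThan
          del: nn_integral_indicator)
  qed
  also have "\<dots> = ennreal ?r"
    using assms sum_nonneg
    by (subst sum_ennreal) (auto simp: ennreal_mult dest!: D0 intro!: G.tail_antimono divide_right_mono)
  finally have "ennreal (tail H x - tail H (x + 1)) \<le> ennreal ?r" .
  moreover have "0 \<le> ?r" using assms sum_nonneg by simp
  ultimately show ?thesis by (simp only: ennreal_le_iff)
qed

text \<open>The intervals decrease to the empty set because 0 is excluded, even if \<open>G\<close>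
  has an atom there.\<close>

lemma exists_measure_G_less:
  assumes "0 < e" "0 < u"
  shows "\<exists>\<epsilon>>0. \<epsilon> \<le> u \<and> measure G {0<..<\<epsilon>} < e"
proof -
  let ?S = "\<lambda>n. {0<..<1 / real (Suc n)}"
  have "(\<lambda>n. measure G (?S n)) \<longlonglongrightarrow> measure G (\<Inter>n. ?S n)"
  proof (rule G.finite_Lim_measure_decseq)
    show "decseq ?S"
      by (intro decseq_SucI) (auto simp: frac_le elim!: order.strict_trans2)
  qed (auto simp: G.sets_eq_borel)
  moreover have "(\<Inter>n. ?S n) = {}"
  proof (rule equals0I)
    fix v assume "v \<in> (\<Inter>n. ?S n)"
    then have v: "0 < v" "v < 1 / real (Suc n)" for n by (simp_all del: of_nat_Suc)
    from v(1) obtain n where "inverse (real (Suc n)) < v" using reals_Archimedean by blast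
    with v(2)[of n] show False by (simp add: inverse_eq_divide)
  qed
  ultimately have "eventually (\<lambda>n. measure G (?S n) < e) sequentially"
    using order_tendstoD(2)[of _ "measure G {}"] assms by simp
  then obtain n where n: "measure G (?S n) < e" by (auto simp: eventually_sequentially)
  let ?\<epsilon> = "min u (1 / real (Suc n))"
  have "measure G {0<..<?\<epsilon>} \<le> measure G (?S n)"
    by (intro G.finite_measure_mono) (auto simp: G.sets_eq_borel)
  with n \<open>0 < u\<close> show ?thesis by (intro exI[of _ ?\<epsilon>]) auto
qed

lemma long_tailed_H_if_atom_condition:
  assumes atoms: "\<And>d. 0 < d \<Longrightarrow> 0 < measure F {d} \<Longrightarrow>
    (\<lambda>x. tail G (x / d) - tail G ((x + 1) / d)) \<in> o[at_top](tail H)"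
  shows H.long_tailed
proof (rule H.long_tailedI)
  fix \<eta>' :: real assume "0 < \<eta>'"
  \<comment> \<open>One quarter for each of the four error terms of
    \<open>diff_tail_H_le\<close>.\<close>
  define \<eta> where "\<eta> = \<eta>' / 4"
  have \<eta>: "0 < \<eta>" using \<open>0 < \<eta>'\<close> by (simp add: \<eta>_def)
  obtain u where u: "0 < u" "0 < tail G u" using exists_tail_G_pos by blast
  \<comment> \<open>Smallness relative to \<open>tail G u\<close> turns the contribution of small
    weights into \<open>\<eta> * tail H x\<close> through \<open>tail_H_ge\<close>.\<close>
  obtain \<epsilon> where \<epsilon>: "0 < \<epsilon>" "\<epsilon> \<le> u" "measure G {0<..<\<epsilon>} < \<eta> * tail G u"
    using exists_measure_G_less[of "\<eta> * tail G u" u] \<eta> u by auto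
  obtain K0 where K0: "tail F t - tail F (t + 1 / \<epsilon>) \<le> \<eta> * tail F t" if "K0 \<le> t" for t
    using F.long_tailed_diff[OF F.subexponential_imp_long_tailed[OF subexp] \<eta>, of "1 / \<epsilon>"]
    by (auto simp: eventually_at_top_linorder)
  define K where "K = max 1 K0"
  have K: "0 < K" "K0 \<le> K" by (auto simp: K_def)
  \<comment> \<open>The factor \<open>tail F K\<close> is what \<open>tail_H_ge\<close> at
    \<open>u = x / K\<close> asks for to bound \<open>\<delta> * tail G (x / K)\<close> by
    \<open>\<eta> * tail H x\<close>.\<close>
  define \<delta> where "\<delta> = \<eta> * tail F K"
  have \<delta>: "0 < \<delta>" using \<eta> tail_F_pos by (simp add: \<delta>_def)
  define D where "D = {d. 0 < d \<and> \<delta> \<le> measure F {d}}"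
  obtain h where h: "0 < h" "\<forall>z\<in>{0..K}. measure F ({z<..<z + h} - D) < \<delta>"
    using F.exists_uniformly_small_gap[OF \<delta>, of K] unfolding D_def by blast
  have "(\<lambda>x. \<Sum>d\<in>D. tail G (x / d) - tail G ((x + 1) / d)) \<in> o[at_top](tail H)"
    using \<delta> by (intro big_sum_in_smallo atoms) (auto simp: D_def)
  then have "eventually (\<lambda>x. norm (\<Sum>d\<in>D. tail G (x / d) - tail G ((x + 1) / d)) \<le> \<eta> * norm (tail H x)) at_top"
    using \<eta> by (rule landau_o.smallD)
  then show "eventually (\<lambda>x. tail H x - tail H (x + 1) \<le> \<eta>' * tail H x) at_top"
    using eventually_gt_at_top[of "0::real"] eventually_gt_at_top[of "K / h"]
  proof eventually_elim
    case (elim x)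
    have "tail H x - tail H (x + 1)
      \<le> tail F (x / u) * measure G {0<..<\<epsilon>} + \<eta> * tail H x
        + (\<Sum>d\<in>D. tail G (x / d) - tail G ((x + 1) / d)) + \<delta> * tail G (x / K)"
      using \<epsilon> \<eta> K K0 \<delta> h elim
      by (intro diff_tail_H_le[OF _ _ _ _ _ _ _ D_def h(2)]) (auto simp: field_simps)
    moreover have "tail F (x / u) * measure G {0<..<\<epsilon>} \<le> \<eta> * tail H x"
    proof -
      have "tail F (x / u) * measure G {0<..<\<epsilon>} \<le> tail F (x / u) * (\<eta> * tail G u)"
        using \<epsilon> by (intro mult_left_mono) auto
      also have "\<dots> = \<eta> * (tail G u * tail F (x / u))" by simp
      also have "\<dots> \<le> \<eta> * tail H x"
        using \<eta> u elim by (intro mult_left_mono tail_H_ge) auto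
      finally show ?thesis .
    qed
    moreover have "\<delta> * tail G (x / K) \<le> \<eta> * tail H x"
    proof -
      have "\<delta> * tail G (x / K) = \<eta> * (tail G (x / K) * tail F (x / (x / K)))"
        using elim K by (simp add: \<delta>_def)
      also have "\<dots> \<le> \<eta> * tail H x"
        using \<eta> K elim by (intro mult_left_mono tail_H_ge) auto
      finally show ?thesis .
    qed
    moreover have "(\<Sum>d\<in>D. tail G (x / d) - tail G ((x + 1) / d)) \<le> \<eta> * tail H x"
      using elim by simp
    ultimately show ?case by (simp add: \<eta>_def)
  qed
qed

text \<open>With no positive atoms the quantifier is vacuous, so the two alternatives of the theorem
  merge into this single condition.\<close>

lemma subexponential_H_iff:
  "subexponential H \<longleftrightarrow> (\<forall>d\<in>discont_points F.
    (\<lambda>x. tail G (x / d) - tail G ((x + 1) / d)) \<in> o[at_top](tail H))"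
proof
  assume "subexponential H"
  then have H.long_tailed by (rule H.subexponential_imp_long_tailed)
  then show "\<forall>d\<in>discont_points F. (\<lambda>x. tail G (x / d) - tail G ((x + 1) / d)) \<in> o[at_top](tail H)"
    by (auto simp: discont_points_def intro: atom_condition_if_long_tailed)
next
  assume "\<forall>d\<in>discont_points F. (\<lambda>x. tail G (x / d) - tail G ((x + 1) / d)) \<in> o[at_top](tail H)"
  then have H.long_tailed
    by (intro long_tailed_H_if_atom_condition) (auto simp: discont_points_def)
  then show "subexponential H" by (rule subexponential_H_if_long_tailed)
qed

end

theorem theorem1p1:
  fixes M :: "'a measure" and X Y :: "'a \<Rightarrow> real" and F G H :: "real measure"
  assumes "prob_space M"
    and "X \<in> borel_measurable M" and "Y \<in> borel_measurable M"
    and "prob_space.indep_var M borel X borel Y"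
    and "AE \<omega> in M. X \<omega> \<ge> 0" and "AE \<omega> in M. Y \<omega> \<ge> 0"
    and "F = distr M borel X" and "G = distr M borel Y"
    and "G \<noteq> return borel 0"
    and "H = distr M borel (\<lambda>\<omega>. X \<omega> * Y \<omega>)"
    and "subexponential F"
  shows "subexponential H \<longleftrightarrow>
           (discont_points F = {} \<or>
            (discont_points F \<noteq> {} \<and>
             (\<forall>d \<in> discont_points F.
                (\<lambda>x. tail G (x / d) - tail G ((x + 1) / d)) \<in> o[at_top](tail H))))"
proof -
  interpret prob_space M by fact
  note [measurable] = assms(2,3)
  interpret G: nonneg_distribution G
    unfolding assms(8) using assms(1,3,6) by (rule nonneg_distribution_distr)
  interpret F: nonneg_distribution F
    unfolding assms(7) using assms(1,2,5) by (rule nonneg_distribution_distr)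
  \<comment> \<open>Independence enters here: the joint law of \<open>X\<close> and \<open>Y\<close>
    is the product of their laws.\<close>
  have "F \<Otimes>\<^sub>M G = distr M (borel \<Otimes>\<^sub>M borel) (\<lambda>\<omega>. (X \<omega>, Y \<omega>))"
    using assms(4) unfolding assms(7,8) by (simp add: indep_var_distribution_eq)
  then have "H = distr (F \<Otimes>\<^sub>M G) borel (\<lambda>p. fst p * snd p)"
    unfolding assms(10) by (simp add: distr_distr comp_def)
  then interpret product_distribution F G H
    using assms(11) G.tail_0_pos[OF assms(9)] by unfold_locales
  show ?thesis
    unfolding subexponential_H_iff by auto
qed

end
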